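(* Let $(M,g)$ be a compact Riemannian manifold (if $\partial M\neq\emptyset$, Dirichlet or Neumann boundary conditions are imposed), and suppose that $\{\phi_j\}$ is an $L^\infty$ quantum ergodic sequence of $L^2$-normalized eigenfunctions of the Laplacian $\Delta_g$. Then there exists $\epsilon>0$ so that $\|\phi_j\|_{L^1(M)}\ge\epsilon>0$ for all $j$.
   Context: $\Delta_g$ is the Laplace–Beltrami operator and $dV$ the Riemannian volume measure of $(M,g)$. A sequence $\{\phi_j\}$ of $L^2$-normalized eigenfunctions is called $L^\infty$ quantum ergodic (on the base) if $$\int_M f\,|\phi_j|^2\,dV\to\frac{1}{\mathrm{Vol}(M)}\int_M f\,dV\qquad\text{for all } f\in L^\infty(M),$$ i.e. $|\phi_j|^2$ converges weakly in $L^1(M,dV)$ to the constant $1/\mathrm{Vol}(M)$ (the constant $1$ if the volume is normalized to be $1$). *)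

theory Defs
  imports "HOL-Analysis.Analysis"
begin

text \<open>
  An arbitrary but fixed coordinate of \<open>\<real>\<^sup>n\<close> (the index type \<open>'n\<close> carries no order, so there is no
  ``last'' coordinate) cuts out the model half-space of manifolds with boundary. Points
  with positive distinguished coordinate model the interior.
\<close>

definition bdry_index :: "'n::finite" where
  "bdry_index = (SOME i. True)"

definition half_space :: "(real ^ 'n) set" where
  "half_space = {x. 0 \<le> x $ bdry_index}"

text \<open>
  The derivative within the half-space is one-sided at boundary points and the ordinary one elsewhere;
  it is unique because the half-space contains segments in all coordinate directions.
\<close>

definition pd :: "'n::finite \<Rightarrow> (real ^ 'n \<Rightarrow> 'b::real_normed_vector) \<Rightarrow> real ^ 'n \<Rightarrow> 'b" where
  "pd i f x = frechet_derivative f (at x within half_space) (axis i 1)"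

text \<open>
  \<open>C\<^sup>m\<close> regularity up to the boundary. Meaningful only for \<open>S\<close> relatively open in the half-space, so
  that values of \<open>f\<close> outside \<open>S\<close> do not influence the derivatives.
\<close>

primrec Cm_on :: "nat \<Rightarrow> (real ^ 'n) set \<Rightarrow> (real ^ 'n \<Rightarrow> 'b::real_normed_vector) \<Rightarrow> bool" where
  "Cm_on 0 S f \<longleftrightarrow> continuous_on S f"
| "Cm_on (Suc m) S f \<longleftrightarrow>
     (\<forall>x\<in>S. f differentiable (at x within half_space)) \<and> (\<forall>i. Cm_on m S (pd i f))"

definition smooth_on :: "(real ^ 'n) set \<Rightarrow> (real ^ 'n \<Rightarrow> 'b::real_normed_vector) \<Rightarrow> bool" where
  "smooth_on S f \<longleftrightarrow> (\<forall>m. Cm_on m S f)"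

type_synonym ('a, 'n) chart = "'a set \<times> ('a \<Rightarrow> real ^ 'n)"

text \<open>
  \<open>metric M c x\<close> is the matrix \<open>(g\<^sub>i\<^sub>j)\<close> of the Riemannian metric in the chart \<open>c\<close>, as a function of the
  coordinate vector \<open>x\<close> in the image of \<open>c\<close>. The dimension is \<open>CARD('n)\<close>.
\<close>

record ('a, 'n) riem =
  space_top :: "'a topology"
  atlas :: "('a, 'n::finite) chart set"
  metric :: "('a, 'n) chart \<Rightarrow> real ^ 'n \<Rightarrow> real ^ 'n ^ 'n"

definition chart_inv :: "('a, 'n::finite) chart \<Rightarrow> real ^ 'n \<Rightarrow> 'a" where
  "chart_inv c = inv_into (fst c) (snd c)"

definition transition :: "('a, 'n::finite) chart \<Rightarrow> ('a, 'n) chart \<Rightarrow> real ^ 'n \<Rightarrow> real ^ 'n" where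
  "transition c d = snd d \<circ> chart_inv c"

definition is_chart :: "'a topology \<Rightarrow> ('a, 'n::finite) chart \<Rightarrow> bool" where
  "is_chart X c \<longleftrightarrow>
     openin X (fst c) \<and>
     openin (top_of_set half_space) (snd c ` fst c) \<and>
     homeomorphic_map (subtopology X (fst c)) (top_of_set (snd c ` fst c)) (snd c)"

definition compact_smooth_manifold :: "('a, 'n::finite) riem \<Rightarrow> bool" where
  "compact_smooth_manifold M \<longleftrightarrow>
     Hausdorff_space (space_top M) \<and> second_countable (space_top M) \<and> compact_space (space_top M) \<and>
     (\<forall>c\<in>atlas M. is_chart (space_top M) c) \<and>
     (\<Union>c\<in>atlas M. fst c) = topspace (space_top M) \<and>
     (\<forall>c\<in>atlas M. \<forall>d\<in>atlas M. smooth_on (snd c ` (fst c \<inter> fst d)) (transition c d))"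

definition riemannian_metric :: "('a, 'n::finite) riem \<Rightarrow> bool" where
  "riemannian_metric M \<longleftrightarrow>
     (\<forall>c\<in>atlas M. smooth_on (snd c ` fst c) (metric M c) \<and>
        (\<forall>x\<in>snd c ` fst c. transpose (metric M c x) = metric M c x \<and>
           (\<forall>v. v \<noteq> 0 \<longrightarrow> 0 < v \<bullet> (metric M c x *v v)))) \<and>
     (\<forall>c\<in>atlas M. \<forall>d\<in>atlas M. \<forall>x\<in>snd c ` (fst c \<inter> fst d).
        (let J = jacobian (transition c d) (at x within half_space)
         in metric M c x = transpose J ** metric M d (transition c d x) ** J))"

definition compact_riemannian_manifold :: "('a, 'n::finite) riem \<Rightarrow> bool" where
  "compact_riemannian_manifold M \<longleftrightarrow> compact_smooth_manifold M \<and> riemannian_metric M"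

definition manifold_boundary :: "('a, 'n::finite) riem \<Rightarrow> 'a set" where
  "manifold_boundary M = {p. \<exists>c\<in>atlas M. p \<in> fst c \<and> snd c p $ bdry_index = 0}"

text \<open>
  The Riemannian volume measure: the Borel measure given by \<open>sqrt (det g) dx\<close> in every chart. By the
  change of variables formula these local measures agree on overlaps, and since countably many charts
  cover \<open>M\<close> they determine exactly one Borel measure.
\<close>

definition riemannian_volume :: "('a, 'n::finite) riem \<Rightarrow> 'a measure \<Rightarrow> bool" where
  "riemannian_volume M V \<longleftrightarrow>
     sets V = sets (sigma (topspace (space_top M)) {U. openin (space_top M) U}) \<and>
     (\<forall>c\<in>atlas M. \<forall>A\<in>sets V. A \<subseteq> fst c \<longrightarrow>
        emeasure V A =
          (\<integral>\<^sup>+ x. ennreal (sqrt (det (metric M c x))) * indicator (snd c ` A) x \<partial>lborel))"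

definition smooth_function :: "('a, 'n::finite) riem \<Rightarrow> ('a \<Rightarrow> complex) \<Rightarrow> bool" where
  "smooth_function M u \<longleftrightarrow> (\<forall>c\<in>atlas M. smooth_on (snd c ` fst c) (u \<circ> chart_inv c))"

text \<open>\<open>\<Delta>u = |g|\<^sup>-\<^sup>1\<^sup>/\<^sup>2 \<Sum>\<^sub>i \<partial>\<^sub>i (\<Sum>\<^sub>j |g|\<^sup>1\<^sup>/\<^sup>2 g\<^sup>i\<^sup>j \<partial>\<^sub>j u)\<close> at coordinates \<open>x\<close> of the chart \<open>c\<close>, with
  \<open>|g|\<close> the determinant and \<open>(g\<^sup>i\<^sup>j)\<close> the inverse of the metric matrix.\<close>

definition laplacian_in_chart ::
    "('a, 'n::finite) riem \<Rightarrow> ('a, 'n) chart \<Rightarrow> ('a \<Rightarrow> complex) \<Rightarrow> real ^ 'n \<Rightarrow> complex" where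
  "laplacian_in_chart M c u x =
     (\<Sum>i\<in>UNIV. pd i (\<lambda>y. \<Sum>j\<in>UNIV.
        (sqrt (det (metric M c y)) * matrix_inv (metric M c y) $ i $ j) *\<^sub>R pd j (u \<circ> chart_inv c) y) x)
     /\<^sub>R sqrt (det (metric M c x))"

text \<open>
  The outward unit normal at a boundary point is \<open>\<nu>\<^sup>j = - g\<^sup>k\<^sup>j / sqrt (g\<^sup>k\<^sup>k)\<close>, where \<open>k\<close> is the
  distinguished coordinate and the manifold lies on the side where it is nonnegative.
\<close>

definition normal_derivative_in_chart ::
    "('a, 'n::finite) riem \<Rightarrow> ('a, 'n) chart \<Rightarrow> ('a \<Rightarrow> complex) \<Rightarrow> real ^ 'n \<Rightarrow> complex" where
  "normal_derivative_in_chart M c u x =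
     (let h = matrix_inv (metric M c x); k = bdry_index
      in - (\<Sum>j\<in>UNIV. (h $ k $ j / sqrt (h $ k $ k)) *\<^sub>R pd j (u \<circ> chart_inv c) x))"

text \<open>Both expressions are independent of the chart, so any chart around the point may be used.\<close>

definition chart_at :: "('a, 'n::finite) riem \<Rightarrow> 'a \<Rightarrow> ('a, 'n) chart" where
  "chart_at M p = (SOME c. c \<in> atlas M \<and> p \<in> fst c)"

definition laplacian :: "('a, 'n::finite) riem \<Rightarrow> ('a \<Rightarrow> complex) \<Rightarrow> 'a \<Rightarrow> complex" where
  "laplacian M u p = (let c = chart_at M p in laplacian_in_chart M c u (snd c p))"

definition normal_derivative :: "('a, 'n::finite) riem \<Rightarrow> ('a \<Rightarrow> complex) \<Rightarrow> 'a \<Rightarrow> complex" where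
  "normal_derivative M u p = (let c = chart_at M p in normal_derivative_in_chart M c u (snd c p))"

datatype boundary_condition = Dirichlet | Neumann

text \<open>Vacuous when the boundary is empty.\<close>

fun satisfies_bc :: "('a, 'n::finite) riem \<Rightarrow> boundary_condition \<Rightarrow> ('a \<Rightarrow> complex) \<Rightarrow> bool" where
  "satisfies_bc M Dirichlet u \<longleftrightarrow> (\<forall>p\<in>manifold_boundary M. u p = 0)"
| "satisfies_bc M Neumann u \<longleftrightarrow> (\<forall>p\<in>manifold_boundary M. normal_derivative M u p = 0)"

text \<open>
  By elliptic regularity eigenfunctions in the \<open>L\<^sup>2\<close> sense have representatives that are smooth up to the
  boundary. Eigenvalues are real by self-adjointness; the sign convention is \<open>\<Delta>u = - \<mu> u\<close>.
\<close>

definition laplace_eigenfunction ::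
    "('a, 'n::finite) riem \<Rightarrow> boundary_condition \<Rightarrow> ('a \<Rightarrow> complex) \<Rightarrow> bool" where
  "laplace_eigenfunction M bc u \<longleftrightarrow>
     smooth_function M u \<and> satisfies_bc M bc u \<and>
     (\<exists>p\<in>topspace (space_top M). u p \<noteq> 0) \<and>
     (\<exists>\<mu>::real. \<forall>p\<in>topspace (space_top M). laplacian M u p = - (\<mu> *\<^sub>R u p))"

definition L1_norm :: "'a measure \<Rightarrow> ('a \<Rightarrow> complex) \<Rightarrow> real" where
  "L1_norm V u = (\<integral>x. cmod (u x) \<partial>V)"

definition L2_norm :: "'a measure \<Rightarrow> ('a \<Rightarrow> complex) \<Rightarrow> real" where
  "L2_norm V u = sqrt (\<integral>x. (cmod (u x))\<^sup>2 \<partial>V)"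

definition L_infinity :: "'a measure \<Rightarrow> ('a \<Rightarrow> real) set" where
  "L_infinity V = {f \<in> borel_measurable V. \<exists>C. AE x in V. \<bar>f x\<bar> \<le> C}"

text \<open>Real test functions suffice: the complex case follows by linearity.\<close>

definition Linf_quantum_ergodic :: "'a measure \<Rightarrow> (nat \<Rightarrow> 'a \<Rightarrow> complex) \<Rightarrow> bool" where
  "Linf_quantum_ergodic V \<phi> \<longleftrightarrow>
     (\<forall>f\<in>L_infinity V.
        (\<lambda>j. \<integral>x. f x * (cmod (\<phi> j x))\<^sup>2 \<partial>V)
          \<longlonglongrightarrow> 1 / measure V (space V) * (\<integral>x. f x \<partial>V))"

end

theory Submission
  imports Defs
begin

text \<open>
  Testing with \<open>1\<close> shows that the volume is finite. If the \<open>L\<^sup>1\<close> norms were not bounded below, a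
  subsequence would tend to \<open>0\<close> in \<open>L\<^sup>1\<close>, and a further one almost everywhere. The latter is
  pointwise bounded almost everywhere, hence bounded by a constant \<open>K\<close> on a set \<open>E\<close> of positive
  measure. There \<open>\<integral>\<^sub>E |\<phi>\<^sub>j|\<^sup>2 \<le> K \<integral> |\<phi>\<^sub>j|\<close> tends to \<open>0\<close>, whereas quantum ergodicity tested with the
  indicator of \<open>E\<close> gives the positive limit \<open>Vol E / Vol M\<close>.
\<close>

text \<open>The sets \<open>E n\<close>, on which the bound \<open>n\<close> works for all
  \<open>k\<close> at once, cover almost every point. Countably many null sets cannot do so in a
  space of nonzero measure.\<close>

lemma (in finite_measure) AE_Bseq_imp_uniform_bound:
  fixes u :: "nat \<Rightarrow> 'a \<Rightarrow> real"
  assumes [measurable]: "\<And>k. u k \<in> borel_measurable M"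
    and bdd: "AE x in M. Bseq (\<lambda>k. u k x)"
    and nonzero: "measure M (space M) \<noteq> 0"
  obtains K E where "E \<in> sets M" "0 < measure M E" "\<And>k x. x \<in> E \<Longrightarrow> \<bar>u k x\<bar> \<le> K"
proof -
  define E where "E = (\<lambda>n::nat. {x \<in> space M. \<forall>k. \<bar>u k x\<bar> \<le> real n})"
  have E_sets: "E n \<in> sets M" for n
    unfolding E_def by measurable
  have "\<exists>n. measure M (E n) \<noteq> 0"
  proof (rule ccontr)
    assume "\<not> ?thesis"
    then have "E n \<in> null_sets M" for n
      using E_sets by (auto simp: null_sets_def emeasure_eq_measure)
    then have "AE x in M. \<forall>n. x \<notin> E n"
      by (auto simp: AE_all_countable intro: AE_not_in)
    moreover have "AE x in M. \<exists>n. x \<in> E n"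
      using bdd AE_space
    proof eventually_elim
      case (elim x)
      then obtain B where "\<forall>k. \<bar>u k x\<bar> \<le> B"
        by (auto simp: Bseq_def)
      moreover obtain n where "B \<le> real n"
        using real_arch_simple by blast
      ultimately show ?case
        using elim unfolding E_def by (auto intro: order_trans)
    qed
    ultimately have "AE x in M. False"
      by eventually_elim blast
    then show False
      using nonzero by (simp add: AE_iff_measurable[OF sets.top] emeasure_eq_measure)
  qed
  then obtain n where "0 < measure M (E n)"
    by (auto simp: zero_less_measure_iff)
  then show ?thesis
    by (rule that[of "E n" "real n", OF E_sets]) (simp add: E_def)
qed

text \<open>The limit is assumed for every measurable \<open>A\<close> because the set
  \<open>E\<close> used as test set depends on the subsequence \<open>s\<close>.\<close>

lemma (in finite_measure) L1_not_null_if_squares_equidistribute: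
  fixes u :: "nat \<Rightarrow> 'a \<Rightarrow> real"
  assumes int: "\<And>k. integrable M (u k)"
    and lim: "\<And>A. A \<in> sets M \<Longrightarrow>
      (\<lambda>k. \<integral>x. indicator A x * (u k x)\<^sup>2 \<partial>M) \<longlonglongrightarrow> c * measure M A"
    and "c \<noteq> 0" and nonzero: "measure M (space M) \<noteq> 0"
  shows "\<not> (\<lambda>k. \<integral>x. \<bar>u k x\<bar> \<partial>M) \<longlonglongrightarrow> 0"
proof
  assume null: "(\<lambda>k. \<integral>x. \<bar>u k x\<bar> \<partial>M) \<longlonglongrightarrow> 0"
  obtain s where s: "strict_mono s" and s_AE: "AE x in M. (\<lambda>k. u (s k) x) \<longlonglongrightarrow> 0"
    using tendsto_L1_AE_subseq[of M u] int null by auto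
  have "AE x in M. Bseq (\<lambda>k. u (s k) x)"
    using s_AE by eventually_elim (auto intro: convergent_imp_Bseq convergentI)
  then obtain K E where E: "E \<in> sets M" "0 < measure M E"
    and K: "\<And>k x. x \<in> E \<Longrightarrow> \<bar>u (s k) x\<bar> \<le> K"
    using AE_Bseq_imp_uniform_bound[of "\<lambda>k. u (s k)"] int nonzero
    by (metis borel_measurable_integrable)
  have bound: "(\<integral>x. indicator E x * (u (s k) x)\<^sup>2 \<partial>M) \<le> K * (\<integral>x. \<bar>u (s k) x\<bar> \<partial>M)" for k
  proof -
    \<comment> \<open>\<open>K\<close> is known to bound anything only on \<open>E\<close>, so its
      sign comes from a point of \<open>E\<close>. It is needed off \<open>E\<close>, where the
      integrands compare as \<open>0\<close> and \<open>K * \<bar>u (s k) x\<bar>\<close>.\<close>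
    have "E \<noteq> {}"
      using E by auto
    then have "0 \<le> K"
      using K by (meson abs_ge_zero all_not_in_conv order_trans)
    have "(\<integral>x. indicator E x * (u (s k) x)\<^sup>2 \<partial>M) \<le> (\<integral>x. K * \<bar>u (s k) x\<bar> \<partial>M)"
    proof (rule integral_mono')
      show "integrable M (\<lambda>x. K * \<bar>u (s k) x\<bar>)"
        using int by simp
      show "indicator E x * (u (s k) x)\<^sup>2 \<le> K * \<bar>u (s k) x\<bar>" for x
        using mult_right_mono[OF K, of x "\<bar>u (s k) x\<bar>" k] \<open>0 \<le> K\<close>
        by (auto simp: indicator_def power2_eq_square)
    qed (use \<open>0 \<le> K\<close> in auto)
    then show ?thesis
      by simp
  qed
  have "(\<lambda>k. K * (\<integral>x. \<bar>u (s k) x\<bar> \<partial>M)) \<longlonglongrightarrow> 0"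
    using LIMSEQ_subseq_LIMSEQ[OF null s] by (auto simp: o_def intro: tendsto_mult_right_zero)
  then have "(\<lambda>k. \<integral>x. indicator E x * (u (s k) x)\<^sup>2 \<partial>M) \<longlonglongrightarrow> 0"
    by (rule tendsto_sandwich[OF _ _ tendsto_const, rotated 2]) (use bound in auto)
  moreover have "(\<lambda>k. \<integral>x. indicator E x * (u (s k) x)\<^sup>2 \<partial>M) \<longlonglongrightarrow> c * measure M E"
    using LIMSEQ_subseq_LIMSEQ[OF lim[OF E(1)] s] by (simp add: o_def)
  ultimately show False
    using LIMSEQ_unique E(2) \<open>c \<noteq> 0\<close> by force
qed

text \<open>Without a lower bound, arbitrarily small values occur. Each fixed \<open>a i\<close> is
  positive, so values tending to \<open>0\<close> eventually avoid the index \<open>i\<close>; hence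
  the chosen indices leave every finite set.\<close>

lemma positive_seq_bounded_below_or_subseq_null:
  fixes a :: "nat \<Rightarrow> real"
  assumes pos: "\<And>j. 0 < a j"
    and no_bound: "\<nexists>\<epsilon>. 0 < \<epsilon> \<and> (\<forall>j. \<epsilon> \<le> a j)"
  obtains r where "filterlim r at_top sequentially" and "(\<lambda>k. a (r k)) \<longlonglongrightarrow> 0"
proof -
  have "\<exists>j. a j < inverse (real (Suc k))" for k
  proof -
    have "0 < inverse (real (Suc k))"
      by simp
    then show ?thesis
      using no_bound not_le by blast
  qed
  then obtain r where r: "\<And>k. a (r k) < inverse (real (Suc k))"
    by metis
  have lim: "(\<lambda>k. a (r k)) \<longlonglongrightarrow> 0"
  proof (rule tendsto_sandwich[OF _ _ tendsto_const LIMSEQ_inverse_real_of_nat])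
    show "\<forall>\<^sub>F k in sequentially. 0 \<le> a (r k)"
      using pos by (simp add: less_imp_le)
    show "\<forall>\<^sub>F k in sequentially. a (r k) \<le> inverse (real (Suc k))"
      by (intro always_eventually allI less_imp_le r)
  qed
  have "eventually (\<lambda>k. r k \<noteq> i) sequentially" for i
    using order_tendstoD(2)[OF lim pos[of i]] by eventually_elim auto
  then have ev: "eventually (\<lambda>k. \<forall>i\<in>{..<N}. r k \<noteq> i) sequentially" for N
    by (intro eventually_ball_finite) auto
  have "eventually (\<lambda>k. N \<le> r k) sequentially" for N
    using ev[of N] by eventually_elim (metis lessThan_iff not_less)
  then have "filterlim r at_top sequentially"
    by (simp add: filterlim_at_top)
  with lim show ?thesis
    using that by blast
qed

lemma Linf_quantum_ergodic_finite_measure: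
  assumes norm: "\<And>j. L2_norm V (\<phi> j) = 1" and qe: "Linf_quantum_ergodic V \<phi>"
  shows "finite_measure V" "measure V (space V) \<noteq> 0"
proof -
  have "(\<lambda>_. 1) \<in> L_infinity V"
    by (auto simp: L_infinity_def)
  then have "(\<lambda>j. \<integral>x. (cmod (\<phi> j x))\<^sup>2 \<partial>V) \<longlonglongrightarrow> 1 / measure V (space V) * (\<integral>x. 1 \<partial>V)"
    using bspec[OF qe[unfolded Linf_quantum_ergodic_def], of "\<lambda>_. 1"] by simp
  moreover have "(\<integral>x. (cmod (\<phi> j x))\<^sup>2 \<partial>V) = 1" for j
    using norm[of j] by (simp add: L2_norm_def)
  \<comment> \<open>Since \<open>measure\<close> is \<open>0\<close> on sets of infinite measure and
    \<open>1 / 0 = 0\<close>, this equation excludes zero and infinite volume alike.\<close>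
  ultimately have "1 / measure V (space V) * (\<integral>x. 1 \<partial>V) = (1::real)"
    by (simp add: LIMSEQ_const_iff)
  then show nz: "measure V (space V) \<noteq> 0"
    by auto
  show "finite_measure V"
    by (rule finite_measureI) (use nz in \<open>auto simp: measure_def\<close>)
qed

lemma L2_normalized_imp_integrable:
  assumes "finite_measure V" and "L2_norm V u = 1"
  shows "integrable V (\<lambda>x. cmod (u x))"
proof -
  interpret finite_measure V by fact
  \<comment> \<open>A function that is not integrable has integral \<open>0\<close> by convention,
    which would make the norm \<open>0\<close> instead of \<open>1\<close>.\<close>
  have sq: "integrable V (\<lambda>x. (cmod (u x))\<^sup>2)"
    using assms(2) not_integrable_integral_eq by (fastforce simp: L2_norm_def)
  \<comment> \<open>Measurability of the modulus is recovered from that of its square, so nothing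
    about the measurability of \<open>u\<close> itself enters.\<close>
  then have "(\<lambda>x. sqrt ((cmod (u x))\<^sup>2)) \<in> borel_measurable V"
    by measurable
  then have "(\<lambda>x. cmod (u x)) \<in> borel_measurable V"
    by (simp only: real_sqrt_abs abs_norm_cancel)
  then show ?thesis
    using sq by (rule square_integrable_imp_integrable)
qed

text \<open>A vanishing integral of the modulus makes \<open>u\<close> zero almost everywhere,
  against the normalization. Positivity of each single norm is what turns the lack of a uniform
  bound into a failure at infinity.\<close>

lemma L2_normalized_imp_L1_norm_pos:
  assumes "finite_measure V" and "L2_norm V u = 1"
  shows "0 < L1_norm V u"
proof -
  have "L1_norm V u \<noteq> 0"
  proof
    assume "L1_norm V u = 0"
    then have "AE x in V. (cmod (u x))\<^sup>2 = 0"
      using integral_nonneg_eq_0_iff_AE[OF L2_normalized_imp_integrable[OF assms]]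
      by (simp add: L1_norm_def)
    then have "(\<integral>x. (cmod (u x))\<^sup>2 \<partial>V) = 0"
      by (rule integral_eq_zero_AE)
    then show False
      using assms(2) by (simp add: L2_norm_def)
  qed
  then show ?thesis
    by (simp add: L1_norm_def less_le)
qed

theorem lemma4p5:
  fixes M :: "('a, 'n::finite) riem"
    and V :: "'a measure"
    and bc :: boundary_condition
    and \<phi> :: "nat \<Rightarrow> 'a \<Rightarrow> complex"
  assumes "compact_riemannian_manifold M"
    and "riemannian_volume M V"
    and "\<And>j. laplace_eigenfunction M bc (\<phi> j)"
    and "\<And>j. L2_norm V (\<phi> j) = 1"
    and "Linf_quantum_ergodic V \<phi>"
  shows "\<exists>\<epsilon>>0. \<forall>j. L1_norm V (\<phi> j) \<ge> \<epsilon>"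
proof (rule ccontr)
  assume no_bound: "\<not> ?thesis"
  note fin = Linf_quantum_ergodic_finite_measure[OF assms(4,5)]
  interpret finite_measure V by (rule fin)
  obtain r where r: "filterlim r at_top sequentially"
    and null: "(\<lambda>k. L1_norm V (\<phi> (r k))) \<longlonglongrightarrow> 0"
    using positive_seq_bounded_below_or_subseq_null[of "\<lambda>j. L1_norm V (\<phi> j)"] no_bound
      L2_normalized_imp_L1_norm_pos[OF fin(1) assms(4)] by blast
  \<comment> \<open>Equidistribution passes to the indices \<open>r k\<close> because
    \<open>r\<close> tends to infinity; \<open>r\<close> need not be monotone.\<close>
  have "(\<lambda>k. \<integral>x. indicator A x * (cmod (\<phi> (r k) x))\<^sup>2 \<partial>V)
      \<longlonglongrightarrow> 1 / measure V (space V) * measure V A" if "A \<in> sets V" for A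
  proof -
    have "indicator A \<in> L_infinity V"
      using that by (auto simp: L_infinity_def intro!: exI[of _ 1] simp: indicator_def)
    then have "(\<lambda>j. \<integral>x. indicator A x * (cmod (\<phi> j x))\<^sup>2 \<partial>V)
        \<longlonglongrightarrow> 1 / measure V (space V) * (\<integral>x. indicator A x \<partial>V)"
      using assms(5) unfolding Linf_quantum_ergodic_def by blast
    then show ?thesis
      using filterlim_compose[OF _ r] that by simp
  qed
  then show False
    using L1_not_null_if_squares_equidistribute[of "\<lambda>k x. cmod (\<phi> (r k) x)" "1 / measure V (space V)"]
      null fin L2_normalized_imp_integrable[OF fin(1) assms(4)]
    by (simp add: L1_norm_def)
qed

end
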